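(* Let $n\ge 1$ and let $\mathcal{G}$ be a finitely generated abelian semigroup of affine maps on $\mathbb{C}^n$, generated by $f_1,\dots,f_p$ ($p\ge 1$). Let $P\in\Phi(GA(n,\mathbb{C}))$ and $\eta=(n_1,\dots,n_r)$, a tuple of positive integers with $n_1+\dots+n_r=n+1$, be such that $P^{-1}\Phi(\mathcal{G})P\subset \mathcal{K}_{\eta,r}(\mathbb{C})$, and let $w_0=p_2(Pu_0)\in\mathbb{C}^n$ be the associated vector. Then the following are equivalent: (i) $\mathcal{G}$ is hypercyclic; (ii) $J_{\mathcal{G}}(w_0)=\mathbb{C}^n$; (iii) $\overline{\mathcal{G}(w_0)}=\mathbb{C}^n$.
   Context: $MA(n,\mathbb{C})$ is the set of all affine maps $f=(A,a):\mathbb{C}^n\to\mathbb{C}^n$, $f(x)=Ax+a$, with $A\in M_n(\mathbb{C})$, $a\in\mathbb{C}^n$; it is a semigroup under composition. $GA(n,\mathbb{C})$ is the group of those with $A$ invertible. The injective multiplicative map $\Phi: MA(n,\mathbb{C})\to M_{n+1}(\mathbb{C})$ is $\Phi(A,a)=\begin{bmatrix} 1 & 0 \\ a & A \end{bmatrix}$. For $v\in\mathbb{C}^n$, $\mathcal{G}(v)=\{f(v): f\in\mathcal{G}\}$; the bar denotes closure. $\mathcal{G}$ is hypercyclic if there exists $v\in\mathbb{C}^n$ with $\overline{\mathcal{G}(v)}=\mathbb{C}^n$. For $\mathcal{G}$ abelian and generated by $f_1,\dots,f_p$ and $x\in\mathbb{C}^n$, $J_{\mathcal{G}}(x)$ is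 the set of $y\in\mathbb{C}^n$ for which there exist a sequence $(x_m)_m$ in $\mathbb{C}^n$ with $x_m\to x$ and sequences of non-negative integers $(k_m^{(j)})_m$, $j=1,\dots,p$, with $k_m^{(1)}+\dots+k_m^{(p)}\to+\infty$, such that $f_1^{k_m^{(1)}}f_2^{k_m^{(2)}}\cdots f_p^{k_m^{(p)}}(x_m)\to y$ (powers are iterates, products are compositions, and $f^0$ is the identity). For $m\ge1$, $\mathbb{T}_m(\mathbb{C})$ is the set of lower triangular $m\times m$ complex matrices all of whose diagonal entries are equal to one another. For a tuple $\eta=(n_1,\dots,n_r)$ of positive integers with sum $n+1$, $\mathcal{K}_{\eta,r}(\mathbb{C})=\mathbb{T}_{n_1}(\mathbb{C})\oplus\dots\oplus\mathbb{T}_{n_r}(\mathbb{C})$ is the set of block diagonal matrices in $M_{n+1}(\mathbb{C})$ with $k$-th diagonal block in $\mathbb{T}_{n_k}(\mathbb{C})$. For every abelian sub-semigroup $\mathcal{G}$ of $MA(n,\mathbb{C})$ a pair $(P,\eta)$ as in the claim exists. $u_0=(e_{1,1},\dots,e_{r,1})\in\mathbb{C}^{n+1}=\mathbb{C}^{n_1}\times\dots\times\mathbb{C}^{n_r}$ where $e_{k,1}=(1,0,\dots,0)\in\mathbb{C}^{n_k}$, and $p_2:\mathbb{C}\times\mathbb{C}^n\to\mathbb{C}^n$ is $p_2(x_1,\dots,x_{n+1})=(x_2,\dots,x_{n+1})$. (So $Pu_0=(1,w_0)$.) *)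

theory Defs
  imports "HOL-Analysis.Analysis" "HOL-Library.Option_ord"
begin

text \<open>
  The space \<open>\<complex>\<^sup>n\<close> is \<^typ>\<open>complex ^ 'n\<close> for a well-ordered finite index type; the order plays the
  role of the order of the coordinates \<open>1, \<dots>, n\<close>.  The space \<open>\<complex>\<^sup>n\<^sup>+\<^sup>1 = \<complex> \<times> \<complex>\<^sup>n\<close> is indexed by
  \<^typ>\<open>'n option\<close>, where \<^const>\<open>None\<close>, the least element in the order of
  \<^theory>\<open>HOL-Library.Option_ord\<close>, is the index of the extra first coordinate.
\<close>

definition affine_map :: "complex ^ 'n ^ 'n \<Rightarrow> complex ^ 'n \<Rightarrow> complex ^ 'n \<Rightarrow> complex ^ 'n::finite"
  where "affine_map A a = (\<lambda>x. A *v x + a)"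

definition MA :: "(complex ^ 'n \<Rightarrow> complex ^ 'n::finite) set"
  where "MA = {affine_map A a |A a. True}"

definition GA :: "(complex ^ 'n \<Rightarrow> complex ^ 'n::finite) set"
  where "GA = {affine_map A a |A a. invertible A}"

definition Phi :: "complex ^ 'n ^ 'n \<Rightarrow> complex ^ 'n \<Rightarrow> complex ^ 'n option ^ ('n::finite) option"
  where "Phi A a = (\<chi> i j. case i of
      None \<Rightarrow> (case j of None \<Rightarrow> 1 | Some j' \<Rightarrow> 0)
    | Some i' \<Rightarrow> (case j of None \<Rightarrow> a $ i' | Some j' \<Rightarrow> A $ i' $ j'))"

text \<open>An affine map determines its linear part and its translation vector, so this is the image
  of a set of affine maps under \<^const>\<open>Phi\<close>.\<close>

definition Phi_image ::
    "(complex ^ 'n \<Rightarrow> complex ^ 'n) set \<Rightarrow> (complex ^ 'n option ^ ('n::finite) option) set"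
  where "Phi_image S = {Phi A a |A a. affine_map A a \<in> S}"

inductive_set semigroup_generated :: "('a \<Rightarrow> 'a) set \<Rightarrow> ('a \<Rightarrow> 'a) set" for F where
  gen: "f \<in> F \<Longrightarrow> f \<in> semigroup_generated F"
| comp: "f \<in> semigroup_generated F \<Longrightarrow> g \<in> semigroup_generated F \<Longrightarrow> f \<circ> g \<in> semigroup_generated F"

definition abelian :: "('a \<Rightarrow> 'a) set \<Rightarrow> bool"
  where "abelian G \<longleftrightarrow> (\<forall>f\<in>G. \<forall>g\<in>G. f \<circ> g = g \<circ> f)"

definition orbit_of :: "('a \<Rightarrow> 'a) set \<Rightarrow> 'a \<Rightarrow> 'a set"
  where "orbit_of G v = {f v |f. f \<in> G}"

definition hypercyclic :: "('a::topological_space \<Rightarrow> 'a) set \<Rightarrow> bool"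
  where "hypercyclic G \<longleftrightarrow> (\<exists>v. closure (orbit_of G v) = UNIV)"

text \<open>\<open>power_product fs k\<close> is \<open>f\<^sub>1\<^bsup>k\<^sub>1\<^esup> \<circ> \<dots> \<circ> f\<^sub>p\<^bsup>k\<^sub>p\<^esup>\<close> for \<open>fs = [f\<^sub>1, \<dots>, f\<^sub>p]\<close>, with indices shifted to
  start at \<open>0\<close>.\<close>

definition power_product :: "('a \<Rightarrow> 'a) list \<Rightarrow> (nat \<Rightarrow> nat) \<Rightarrow> 'a \<Rightarrow> 'a"
  where "power_product fs k = foldr (\<circ>) (map (\<lambda>j. (fs ! j) ^^ k j) [0..<length fs]) id"

definition J_set :: "('a::topological_space \<Rightarrow> 'a) list \<Rightarrow> 'a \<Rightarrow> 'a set"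
  where "J_set fs x = {y. \<exists>(xs :: nat \<Rightarrow> 'a) (k :: nat \<Rightarrow> nat \<Rightarrow> nat).
      xs \<longlonglongrightarrow> x \<and>
      filterlim (\<lambda>m. \<Sum>j<length fs. k m j) at_top sequentially \<and>
      (\<lambda>m. power_product fs (k m) (xs m)) \<longlonglongrightarrow> y}"

definition rank_of :: "'m::{finite,wellorder} \<Rightarrow> nat"
  where "rank_of i = card {j. j < i}"

text \<open>The indices of the \<open>k\<close>-th diagonal block (counting from \<open>0\<close>) for block sizes \<open>\<eta>\<close>.\<close>

definition block :: "nat list \<Rightarrow> nat \<Rightarrow> 'm::{finite,wellorder} set"
  where "block \<eta> k = {i. sum_list (take k \<eta>) \<le> rank_of i \<and> rank_of i < sum_list (take (Suc k) \<eta>)}"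

text \<open>The submatrix of \<open>M\<close> with index set \<open>B\<close> is lower triangular with constant diagonal.\<close>

definition T_on :: "'m::{finite,wellorder} set \<Rightarrow> complex ^ 'm::_ ^ 'm::_ \<Rightarrow> bool"
  where "T_on B M \<longleftrightarrow>
    (\<forall>i\<in>B. \<forall>j\<in>B. i < j \<longrightarrow> M $ i $ j = 0) \<and> (\<forall>i\<in>B. \<forall>j\<in>B. M $ i $ i = M $ j $ j)"

definition K_set :: "nat list \<Rightarrow> (complex ^ 'm::{finite,wellorder} ^ 'm::_) set"
  where "K_set \<eta> = {M.
      (\<forall>k<length \<eta>. T_on (block \<eta> k) M) \<and>
      (\<forall>k<length \<eta>. \<forall>l<length \<eta>. k \<noteq> l \<longrightarrow> (\<forall>i\<in>block \<eta> k. \<forall>j\<in>block \<eta> l. M $ i $ j = 0))}"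

text \<open>The coordinate \<open>1\<close> occurs exactly at the first index of each block.\<close>

definition u0 :: "nat list \<Rightarrow> complex ^ 'm::{finite,wellorder}"
  where "u0 \<eta> = (\<chi> i. if \<exists>k<length \<eta>. rank_of i = sum_list (take k \<eta>) then 1 else 0)"

definition p2 :: "complex ^ ('n::finite) option \<Rightarrow> complex ^ 'n"
  where "p2 x = (\<chi> i. x $ Some i)"

end

theory Submission
  imports Defs
begin

text \<open>
  In the coordinates \<open>x \<mapsto> P\<^sup>-\<^sup>1 (1, x)\<close> the semigroup becomes a set \<open>S\<close> of pairwise commuting matrices
  in \<open>K_set \<eta>\<close>, the space \<open>\<complex>\<^sup>n\<close> becomes the hyperplane \<open>H\<close> of vectors with first coordinate \<open>1\<close>, and
  \<open>w0\<close> becomes \<open>u0 \<eta>\<close>.  A matrix \<open>T\<close> that commutes with \<open>S\<close> carries the orbit of \<open>x\<close> to the orbit of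
  \<open>T x\<close>, so orbits of different vectors can be compared as soon as such a \<open>T\<close> moves one vector to the
  other.  Matrices in \<open>K_set \<eta>\<close> are lower triangular, and they multiply the coordinate at the start
  of a block by the common diagonal entry of that block; \<open>u0 \<eta>\<close> has the value \<open>1\<close> at these coordinates.

  \<^bold>\<open>A dense orbit yields density of the orbit of \<open>w0\<close>\<close> (\<open>dense_orbit_transfer\<close>).  If the orbit
  of \<open>v\<close> is dense in \<open>H\<close>, it spans the whole space.  Hence \<open>T v = u0 \<eta>\<close> for some \<open>T\<close> in \<open>K_set \<eta>\<close> that
  commutes with \<open>S\<close>.  Comparing the coordinates at the block starts shows that the diagonal of \<open>T\<close> has
  no zero and that \<open>T\<close> preserves the first coordinate.  So \<open>T\<close> maps \<open>H\<close> onto \<open>H\<close> and takes the dense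
  orbit of \<open>v\<close> to a dense orbit of \<open>u0 \<eta>\<close>.

  \<^bold>\<open>\<open>J_set fs w0 = UNIV\<close> yields density of the orbit of \<open>w0\<close>.\<close>  First, every vector has the form
  \<open>T u0\<close> with \<open>T\<close> commuting with \<open>S\<close> (\<open>cyclic_if_limits_cover_hyperplane\<close>).  Otherwise the functionals
  that vanish on all these vectors contain a common left eigenvector \<open>\<phi>\<close> of \<open>S\<close>, whose eigenvalue at
  \<open>M\<close> is a diagonal entry of \<open>M\<close>, hence also the factor by which \<open>M\<close> multiplies some block start
  coordinate.  Along \<open>x\<^sub>m \<longlonglongrightarrow> u0 \<eta>\<close> with \<open>M\<^sub>m x\<^sub>m \<longlonglongrightarrow> y\<close> this factor converges, because the coordinate of
  \<open>x\<^sub>m\<close> tends to \<open>1\<close>, while \<open>\<phi> x\<^sub>m\<close> tends to \<open>\<phi> (u0 \<eta>) = 0\<close>.  So \<open>\<phi> y = 0\<close> for every \<open>y\<close> in \<open>H\<close>, which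
  is impossible.  Secondly, it follows that \<open>x\<^sub>m = (1 + R\<^sub>m) u0\<close> with \<open>R\<^sub>m\<close> commuting with \<open>S\<close> and
  tending to \<open>0\<close>, so \<open>M\<^sub>m u0 \<longlonglongrightarrow> y\<close> as well (\<open>cyclic_vector_limit\<close>).

  \<^bold>\<open>Conversely\<close>, a dense orbit stays dense without the finitely many points reached by power products
  of bounded length, so every point is a limit along products of growing length
  (\<open>dense_orbit_imp_J_set\<close>).
\<close>

section \<open>Power products in an abelian semigroup\<close>

lemma power_product_Nil: "power_product [] k = id"
  by (simp add: power_product_def)

lemma power_product_Cons:
  "power_product (f # fs) k = (f ^^ k 0) \<circ> power_product fs (\<lambda>j. k (Suc j))"
  unfolding power_product_def length_Cons upt_conv_Cons[OF zero_less_Suc]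
    map_Suc_upt[symmetric]
  by (simp add: comp_def)

lemma funpow_commute:
  assumes "f \<circ> g = g \<circ> f" shows "(f ^^ k) \<circ> g = g \<circ> (f ^^ k)"
  by (rule ext, induction k) (use assms in \<open>auto simp: fun_eq_iff\<close>)

lemma power_product_commute:
  assumes "\<And>f. f \<in> set fs \<Longrightarrow> f \<circ> g = g \<circ> f"
  shows "power_product fs k \<circ> g = g \<circ> power_product fs k"
  using assms
proof (induction fs arbitrary: k)
  case Nil
  show ?case by (simp add: power_product_Nil)
next
  case (Cons f fs)
  have 1: "(f ^^ k 0) \<circ> g = g \<circ> (f ^^ k 0)"
    using Cons.prems by (intro funpow_commute) (metis list.set_intros(1))
  have 2: "power_product fs k' \<circ> g = g \<circ> power_product fs k'" for k'
    using Cons by (metis list.set_intros(2))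
  show ?case unfolding power_product_Cons
    by (metis 1 2 comp_assoc)
qed

lemma power_product_add:
  assumes "\<And>f g. f \<in> set fs \<Longrightarrow> g \<in> set fs \<Longrightarrow> f \<circ> g = g \<circ> f"
  shows "power_product fs k \<circ> power_product fs l = power_product fs (\<lambda>j. k j + l j)"
  using assms
proof (induction fs arbitrary: k l)
  case Nil
  show ?case by (simp add: power_product_Nil)
next
  case (Cons f fs)
  let ?k = "power_product fs (\<lambda>j. k (Suc j))" and ?l = "power_product fs (\<lambda>j. l (Suc j))"
  have "(f ^^ l 0) \<circ> ?k = ?k \<circ> (f ^^ l 0)"
    using Cons.prems by (intro funpow_commute power_product_commute[symmetric]) (metis list.set_intros)
  hence "(f ^^ k 0 \<circ> ?k) \<circ> (f ^^ l 0 \<circ> ?l) = (f ^^ k 0 \<circ> f ^^ l 0) \<circ> (?k \<circ> ?l)"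
    by (metis comp_assoc)
  also have "?k \<circ> ?l = power_product fs (\<lambda>j. k (Suc j) + l (Suc j))"
    using Cons by (metis list.set_intros(2))
  finally show ?case
    by (simp add: power_product_Cons funpow_add)
qed

lemma power_product_zero: "power_product fs (\<lambda>j. 0) = id"
  by (induction fs) (simp_all add: power_product_Nil power_product_Cons)

lemma power_product_indicator:
  "j < length fs \<Longrightarrow> power_product fs (\<lambda>i. if i = j then 1 else 0) = fs ! j"
proof (induction fs arbitrary: j)
  case (Cons f fs)
  then show ?case
    by (cases j) (simp_all add: power_product_Cons power_product_zero)
qed simp

lemma power_product_cong:
  "(\<And>j. j < length fs \<Longrightarrow> k j = l j) \<Longrightarrow> power_product fs k = power_product fs l"
  unfolding power_product_def by (intro arg_cong2[where f="foldr (\<circ>)"] refl arg_cong2[where f=map] map_cong) auto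

lemma semigroup_generated_power_product:
  assumes "abelian (semigroup_generated (set fs))" "g \<in> semigroup_generated (set fs)"
  obtains k where "g = power_product fs k"
proof -
  have comm: "f \<circ> g = g \<circ> f" if "f \<in> set fs" "g \<in> set fs" for f g
    using assms(1) that unfolding abelian_def by (blast intro: semigroup_generated.gen)
  have "\<exists>k. g = power_product fs k" using assms(2)
  proof induction
    case (gen f)
    then show ?case by (metis in_set_conv_nth power_product_indicator)
  next
    case (comp f g)
    then obtain k l where "f = power_product fs k" "g = power_product fs l" by blast
    with power_product_add[of fs k l] comm show ?case by blast
  qed
  thus thesis using that by blast
qed

lemma funpow_in_semigroup:
  "f \<in> semigroup_generated F \<Longrightarrow> k > 0 \<Longrightarrow> f ^^ k \<in> semigroup_generated F"
proof (induction k)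
  case (Suc k)
  then show ?case
    by (cases "k = 0") (auto simp del: comp_apply simp: semigroup_generated.comp)
qed simp

lemma power_product_in_semigroup:
  "set fs \<subseteq> F \<Longrightarrow> (\<Sum>j<length fs. k j) > 0 \<Longrightarrow> power_product fs k \<in> semigroup_generated F"
proof (induction fs arbitrary: k)
  case (Cons f fs)
  let ?k = "\<lambda>j. k (Suc j)"
  have f: "k 0 > 0 \<Longrightarrow> f ^^ k 0 \<in> semigroup_generated F"
    using Cons.prems by (auto intro: funpow_in_semigroup semigroup_generated.gen)
  show ?case
  proof (cases "(\<Sum>j<length fs. ?k j) > 0")
    case True
    hence "power_product fs ?k \<in> semigroup_generated F" using Cons by simp
    thus ?thesis using f
      by (cases "k 0 = 0") (auto simp del: comp_apply simp: power_product_Cons semigroup_generated.comp)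
  next
    case False
    hence "power_product fs ?k = power_product fs (\<lambda>j. 0)"
      by (intro power_product_cong) auto
    moreover have "k 0 > 0" using Cons.prems(2) False by (simp add: sum.lessThan_Suc_shift del: sum.lessThan_Suc)
    ultimately show ?thesis using f by (simp add: power_product_Cons power_product_zero)
  qed
qed simp

lemma finite_bounded_power_products:
  "finite {power_product fs k | k. (\<Sum>j<length fs. k j) \<le> N}"
proof (rule finite_subset)
  let ?I = "{..<length fs} \<rightarrow>\<^sub>E {..N}"
  show "finite (power_product fs ` ?I)"
    by (intro finite_imageI finite_PiE) auto
  show "{power_product fs k | k. (\<Sum>j<length fs. k j) \<le> N} \<subseteq> power_product fs ` ?I"
  proof clarify
    fix k assume le: "(\<Sum>j<length fs. k j) \<le> N"
    have "k j \<le> N" if "j < length fs" for j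
      using member_le_sum[of j "{..<length fs}" k] that le by auto
    hence "restrict k {..<length fs} \<in> ?I" by auto
    moreover have "power_product fs k = power_product fs (restrict k {..<length fs})"
      by (intro power_product_cong) auto
    ultimately show "power_product fs k \<in> power_product fs ` ?I" by blast
  qed
qed

text \<open>
  The constant sequence at \<open>w\<close> serves in the definition of \<open>J_set\<close>.  Only finitely many orbit points
  come from exponents of sum at most \<open>m\<close>, and in a space without isolated points the others still
  meet every ball.
\<close>

lemma dense_orbit_imp_J_set:
  fixes fs :: "('a::{metric_space,perfect_space} \<Rightarrow> 'a) list"
  assumes "abelian (semigroup_generated (set fs))"
    and dense: "closure (orbit_of (semigroup_generated (set fs)) w) = UNIV"
  shows "J_set fs w = UNIV"
proof -
  have "y \<in> J_set fs w" for y
  proof -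
    have "\<exists>k. (\<Sum>j<length fs. k j) > m \<and> dist (power_product fs k w) y < inverse (real (Suc m))" for m
    proof -
      let ?F = "(\<lambda>g. g w) ` {power_product fs k | k. (\<Sum>j<length fs. k j) \<le> m}"
      have "finite ?F"
        using finite_bounded_power_products by blast
      hence "infinite (ball y (inverse (real (Suc m))) - ?F)" "open (ball y (inverse (real (Suc m))) - ?F)"
        using islimpt_UNIV[of y] by (auto simp: islimpt_eq_infinite_ball finite_imp_closed open_Diff)
      moreover from this have "ball y (inverse (real (Suc m))) - ?F \<noteq> {}" by (metis finite.emptyI)
      ultimately obtain z where "z \<in> orbit_of (semigroup_generated (set fs)) w"
          "z \<in> ball y (inverse (real (Suc m)))" "z \<notin> ?F"
        using dense open_Int_closure_eq_empty[of "ball y (inverse (real (Suc m))) - ?F"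
            "orbit_of (semigroup_generated (set fs)) w"] by auto
      then show ?thesis
        by (fastforce simp: orbit_of_def dist_commute not_le
            elim!: semigroup_generated_power_product[OF assms(1)])
    qed
    then obtain k where k: "\<And>m. (\<Sum>j<length fs. k m j) > m"
        "\<And>m. dist (power_product fs (k m) w) y < inverse (real (Suc m))" by metis
    have "filterlim (\<lambda>m. \<Sum>j<length fs. k m j) at_top sequentially"
      using k(1) by (intro filterlim_at_top_mono[OF filterlim_ident]) (auto simp: less_imp_le)
    moreover have "(\<lambda>m. power_product fs (k m) w) \<longlonglongrightarrow> y"
      unfolding tendsto_dist_iff[of _ y]
      by (rule Lim_null_comparison[OF _ LIMSEQ_inverse_real_of_nat])
        (use k(2) in \<open>auto intro!: always_eventually simp: less_imp_le\<close>)
    ultimately show ?thesis unfolding J_set_def by (auto intro!: exI[of _ "\<lambda>m. w"])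
  qed
  thus ?thesis by blast
qed

section \<open>Linear functionals as row vectors\<close>

text \<open>Linear functionals are written as row vectors; the pairing is bilinear, without conjugation.\<close>

definition pairing :: "'a::comm_semiring_1 ^ 'm \<Rightarrow> 'a ^ 'm \<Rightarrow> 'a" (infixl "\<star>" 70)
  where "\<phi> \<star> x = (\<Sum>i\<in>UNIV. \<phi> $ i * x $ i)"

lemma pairing_bilinear:
  fixes \<phi> x y :: "'a::comm_ring_1 ^ 'm::finite"
  shows pairing_add_right: "\<phi> \<star> (x + y) = \<phi> \<star> x + \<phi> \<star> y"
    and pairing_add_left: "(\<phi> + \<psi>) \<star> x = \<phi> \<star> x + \<psi> \<star> x"
    and pairing_zero_left: "0 \<star> x = 0"
    and pairing_scale_right: "\<phi> \<star> (c *s x) = c * (\<phi> \<star> x)"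
    and pairing_scale_left: "(c *s \<phi>) \<star> x = c * (\<phi> \<star> x)"
  by (simp_all add: pairing_def sum.distrib sum_distrib_left algebra_simps)

lemma pairing_axis: "\<phi> \<star> axis i 1 = \<phi> $ (i::'m::finite)"
  by (simp add: pairing_def axis_def if_distrib cong: if_cong)

lemma pairing_vector_matrix:
  fixes M :: "'a::comm_semiring_1 ^ 'm::finite ^ 'm"
  shows "(\<phi> v* M) \<star> x = \<phi> \<star> (M *v x)"
proof -
  have "(\<phi> v* M) \<star> x = (\<Sum>j\<in>UNIV. \<Sum>i\<in>UNIV. \<phi> $ i * M $ i $ j * x $ j)"
    by (simp add: pairing_def vector_matrix_mult_def sum_distrib_left sum_distrib_right mult_ac)
  also have "\<dots> = (\<Sum>i\<in>UNIV. \<Sum>j\<in>UNIV. \<phi> $ i * M $ i $ j * x $ j)"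
    by (rule sum.swap)
  also have "\<dots> = \<phi> \<star> (M *v x)"
    by (simp add: pairing_def matrix_vector_mult_def sum_distrib_left mult_ac)
  finally show ?thesis .
qed

lemma tendsto_pairing:
  fixes \<phi> :: "complex ^ 'm::finite"
  shows "(f \<longlongrightarrow> x) F \<Longrightarrow> ((\<lambda>m. \<phi> \<star> f m) \<longlongrightarrow> \<phi> \<star> x) F"
  unfolding pairing_def by (intro tendsto_intros)

lemma continuous_pairing:
  fixes \<phi> :: "complex ^ 'm::finite"
  shows "continuous_on A (\<lambda>x. \<phi> \<star> x)"
  unfolding pairing_def by (intro continuous_intros)

lemma continuous_matrix_vector_mult: "continuous_on A ((*v) (M :: complex ^ 'm::finite ^ 'k::finite))"
  unfolding matrix_vector_mult_def by (intro continuous_intros)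

text \<open>
  The orthogonal complement supplies the functional: a real orthogonal vector \<open>a\<close> only kills the real
  part of the pairing with the conjugate of \<open>a\<close>, but \<open>E\<close> is also closed under multiplication by the
  imaginary unit.
\<close>

lemma proper_subspace_annihilated:
  fixes E :: "(complex ^ 'm::finite) set"
  assumes E: "vec.subspace E" and "E \<noteq> UNIV"
  obtains \<phi> where "\<phi> \<noteq> 0" "\<And>x. x \<in> E \<Longrightarrow> \<phi> \<star> x = 0"
proof -
  have sc: "c *\<^sub>R x = complex_of_real c *s x" for c and x :: "complex ^ 'm"
    by (vector scaleR_conv_of_real)
  have "subspace E"
    using E unfolding subspace_def vec.subspace_def sc by blast
  moreover have "span E \<subset> UNIV"
    using \<open>subspace E\<close> \<open>E \<noteq> UNIV\<close> by (metis span_eq_iff top.not_eq_extremum)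
  ultimately obtain a where a: "a \<noteq> 0" "\<And>x. x \<in> E \<Longrightarrow> orthogonal a x"
    using orthogonal_to_subspace_exists_gen[of E UNIV] by (metis span_UNIV UNIV_I span_eq_iff)
  define \<phi> where "\<phi> = (\<chi> i. cnj (a $ i))"
  have Re: "a \<bullet> x = Re (\<phi> \<star> x)" for x
    by (simp add: inner_vec_def pairing_def \<phi>_def inner_complex_def)
  have "\<phi> \<star> x = 0" if "x \<in> E" for x
  proof -
    have "\<i> *s x \<in> E" using E that by (simp add: vec.subspace_def)
    hence "Re (\<phi> \<star> (\<i> *s x)) = 0" "Re (\<phi> \<star> x) = 0"
      using a(2) that by (auto simp: orthogonal_def Re)
    thus ?thesis by (simp add: pairing_bilinear complex_eq_iff)
  qed
  moreover have "\<phi> \<noteq> 0" using a(1) by (auto simp: \<phi>_def vec_eq_iff)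
  ultimately show thesis using that by blast
qed

text \<open>The hyperplane avoids the origin, so it spans the space; its points \<open>e\<^sub>p\<close> and \<open>e\<^sub>p + e\<^sub>i\<close> suffice.\<close>

lemma functional_vanishing_on_hyperplane:
  fixes \<phi> :: "'a::comm_ring_1 ^ 'm::finite"
  assumes "\<And>y. y $ p = 1 \<Longrightarrow> \<phi> \<star> y = 0"
  shows "\<phi> = 0"
proof -
  have p: "\<phi> $ p = 0"
    using assms[of "axis p 1"] by (simp add: pairing_axis)
  have "\<phi> $ i = 0" if "i \<noteq> p" for i
    using assms[of "axis p 1 + axis i 1"] that p
    by (simp add: pairing_bilinear pairing_axis) (simp add: axis_def)
  with p show ?thesis by (metis vec_eq_iff zero_index)
qed

section \<open>Common left eigenvectors of triangular matrices\<close>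

definition lower_triangular :: "'a::zero ^ 'm::{finite,linorder} ^ 'm::_ \<Rightarrow> bool"
  where "lower_triangular M \<longleftrightarrow> (\<forall>i j. i < j \<longrightarrow> M $ i $ j = 0)"

text \<open>
  Among the nonzero members of \<open>W\<close>, take a \<open>\<phi>\<close> whose last nonzero coordinate \<open>t\<close> comes earliest.  Since
  \<open>M\<close> is lower triangular, \<open>\<phi> M\<close> has no entries after \<open>t\<close> and the entry \<open>M\<^sub>t\<^sub>t \<phi>\<^sub>t\<close> at \<open>t\<close>.  So
  \<open>\<phi> M - M\<^sub>t\<^sub>t \<phi>\<close> lies in \<open>W\<close> and ends before \<open>t\<close>, and therefore it is zero.  The index \<open>t\<close>, chosen
  independently of \<open>M\<close>, identifies the eigenvalues.
\<close>

lemma lower_triangular_left_eigenvector: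
  fixes W :: "('a::field ^ 'm::{finite,wellorder}) set"
  assumes W: "vec.subspace W" "W \<noteq> {0}"
    and inv: "\<And>\<phi> M. \<phi> \<in> W \<Longrightarrow> M \<in> S \<Longrightarrow> \<phi> v* M \<in> W"
    and tri: "\<And>M. M \<in> S \<Longrightarrow> lower_triangular M"
  obtains \<phi> t where "\<phi> \<in> W" "\<phi> \<noteq> 0" "\<And>M. M \<in> S \<Longrightarrow> \<phi> v* M = M $ t $ t *s \<phi>"
proof -
  define Q where "Q t \<longleftrightarrow> (\<exists>\<phi>\<in>W. \<phi> \<noteq> 0 \<and> (\<forall>i>t. \<phi> $ i = 0))" for t
  obtain \<phi>0 where "\<phi>0 \<in> W" "\<phi>0 \<noteq> 0"
    using W by (auto simp: vec.subspace_def)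
  moreover have "\<not> i > Max UNIV" for i :: 'm by (auto simp: not_less intro: Max_ge)
  ultimately have "Q (Max UNIV)" unfolding Q_def by blast
  define t where "t = (LEAST t. Q t)"
  have "Q t" unfolding t_def by (rule LeastI) fact
  then obtain \<phi> where \<phi>: "\<phi> \<in> W" "\<phi> \<noteq> 0" "\<And>i. i > t \<Longrightarrow> \<phi> $ i = 0"
    unfolding Q_def by blast
  have "\<phi> v* M = M $ t $ t *s \<phi>" if M: "M \<in> S" for M
  proof (rule ccontr)
    define \<psi> where "\<psi> = \<phi> v* M - M $ t $ t *s \<phi>"
    assume "\<not> ?thesis"
    hence "\<psi> \<noteq> 0" by (simp add: \<psi>_def)
    have "\<psi> \<in> W" unfolding \<psi>_def
      using W(1) \<phi>(1) inv M by (intro vec.subspace_diff vec.subspace_scale) auto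
    have zero: "\<phi> $ i * M $ i $ j = 0" if "j \<ge> t" "i \<noteq> t \<or> j \<noteq> t" for i j
      using tri[OF M] \<phi>(3)[of i] that unfolding lower_triangular_def
      by (cases "i < j") (auto simp: not_less)
    have \<psi>0: "\<psi> $ j = 0" if "j \<ge> t" for j
    proof (cases "j = t")
      case True
      have "(\<phi> v* M) $ t = (\<Sum>i\<in>UNIV. if i = t then M $ t $ t * \<phi> $ t else 0)"
        unfolding vector_matrix_mult_def vec_lambda_beta
        by (rule sum.cong) (use zero[of t] in \<open>auto simp: mult.commute\<close>)
      thus ?thesis using True by (simp add: \<psi>_def)
    next
      case False
      have "(\<phi> v* M) $ j = 0"
        using zero[OF that] False unfolding vector_matrix_mult_def by (auto intro!: sum.neutral simp: mult.commute)
      thus ?thesis using False that \<phi>(3) by (simp add: \<psi>_def)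
    qed
    let ?s = "Max {i. \<psi> $ i \<noteq> 0}"
    have ne: "{i. \<psi> $ i \<noteq> 0} \<noteq> {}" using \<open>\<psi> \<noteq> 0\<close> by (auto simp: vec_eq_iff)
    have "\<psi> $ i = 0" if "i > ?s" for i
      using that ne by (metis (mono_tags) Max_ge finite leD mem_Collect_eq)
    hence "Q ?s" unfolding Q_def using \<open>\<psi> \<in> W\<close> \<open>\<psi> \<noteq> 0\<close> by blast
    moreover have "?s < t" using ne \<psi>0 Max_in[OF _ ne] by (auto simp: not_le[symmetric])
    ultimately show False unfolding t_def using not_less_Least by blast
  qed
  thus thesis using \<phi> that by blast
qed

section \<open>The commutant\<close>

definition commutant :: "('a::semiring_1 ^ 'm ^ 'm::finite) set \<Rightarrow> ('a ^ 'm ^ 'm) set"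
  where "commutant S = {T. \<forall>M\<in>S. T ** M = M ** T}"

text \<open>The product with \<open>mat c\<close> serves as multiplication of a matrix by the scalar \<open>c\<close>.\<close>

lemma mat_mult_eq:
  fixes A :: "'a::comm_semiring_1 ^ 'm ^ 'm::finite"
  shows "mat c ** A = (\<chi> i j. c * A $ i $ j)" "A ** mat c = (\<chi> i j. c * A $ i $ j)"
  by (simp_all add: matrix_matrix_mult_def mat_def vec_eq_iff if_distrib if_distribR mult.commute cong: if_cong)

lemma mat_mult_vector:
  fixes A :: "'a::comm_semiring_1 ^ 'm ^ 'm::finite"
  shows "(mat c ** A) *v x = c *s (A *v x)"
  by (simp add: mat_mult_eq matrix_vector_mult_def vec_eq_iff sum_distrib_left mult_ac)

text \<open>
  The linear space \<open>K\<close> prescribes the shape of the commuting matrices: triangular when such a matrix has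
  to be inverted, arbitrary when only the set of reachable vectors matters.
\<close>

lemma subspace_commutant_orbit:
  fixes S K :: "('a::field ^ 'm ^ 'm::finite) set" and u :: "'a ^ 'm"
  assumes K: "0 \<in> K" "\<And>A B. A \<in> K \<Longrightarrow> B \<in> K \<Longrightarrow> A + B \<in> K"
    "\<And>c A. A \<in> K \<Longrightarrow> mat c ** A \<in> K"
  shows "vec.subspace {T *v u |T. T \<in> K \<inter> commutant S}"
proof -
  have 0: "0 \<in> commutant S"
    by (simp add: commutant_def matrix_matrix_mult_def vec_eq_iff)
  have add: "A + B \<in> commutant S" if "A \<in> commutant S" "B \<in> commutant S" for A B
    using that by (simp add: commutant_def matrix_add_ldistrib matrix_matrix_mult_def sum.distrib vec_eq_iff algebra_simps)
  have scale: "mat c ** A \<in> commutant S" if "A \<in> commutant S" for c A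
    using that by (auto simp: commutant_def mat_mult_eq(2)[symmetric] mat_mult_eq(1) simp flip: matrix_mul_assoc)
      (metis mat_mult_eq matrix_mul_assoc)
  show ?thesis
    unfolding vec.subspace_def
  proof (intro conjI ballI allI)
    show "0 \<in> {T *v u |T. T \<in> K \<inter> commutant S}"
      using 0 K(1) by (metis (mono_tags, lifting) IntI matrix_vector_mult_0 mem_Collect_eq)
    show "x + y \<in> {T *v u |T. T \<in> K \<inter> commutant S}"
      if "x \<in> {T *v u |T. T \<in> K \<inter> commutant S}" "y \<in> {T *v u |T. T \<in> K \<inter> commutant S}" for x y
      using that K(2) add by (auto simp flip: matrix_vector_mult_add_rdistrib)
    show "c *s x \<in> {T *v u |T. T \<in> K \<inter> commutant S}"
      if "x \<in> {T *v u |T. T \<in> K \<inter> commutant S}" for c x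
      using that K(3) scale by (auto simp flip: mat_mult_vector)
  qed
qed

section \<open>Limits of orbits of a cyclic vector\<close>

text \<open>
  If \<open>z\<close> is perturbed by terms that are small relative to \<open>z\<close> itself, then boundedness of the sum bounds
  \<open>z\<close>, which makes the perturbation small in absolute terms.  This replaces inverting \<open>1 + R\<^sub>m\<close> for
  operators \<open>R\<^sub>m\<close> that tend to zero.
\<close>

lemma tendsto_perturbation:
  fixes z w :: "nat \<Rightarrow> 'a::real_normed_vector"
  assumes lim: "(\<lambda>m. z m + w m) \<longlonglongrightarrow> y"
    and small: "\<And>m. norm (w m) \<le> \<epsilon> m * norm (z m)" and "\<epsilon> \<longlonglongrightarrow> 0"
  shows "z \<longlonglongrightarrow> y"
proof -
  obtain B where B: "\<And>m. norm (z m + w m) \<le> B"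
    using convergent_imp_Bseq[OF convergentI[OF lim]] by (auto simp: Bseq_def)
  have "\<forall>\<^sub>F m in sequentially. \<epsilon> m < 1 / 2"
    by (rule order_tendstoD(2)[OF \<open>\<epsilon> \<longlonglongrightarrow> 0\<close>]) simp
  hence "\<forall>\<^sub>F m in sequentially. norm (w m) \<le> \<bar>\<epsilon> m\<bar> * (2 * B)"
  proof eventually_elim
    case (elim m)
    have "norm (z m) \<le> norm (z m + w m) + norm (w m)"
      by (metis add_diff_cancel_right' norm_triangle_ineq4)
    also have "norm (w m) \<le> 1 / 2 * norm (z m)"
      using small[of m] elim by (meson less_imp_le mult_right_mono norm_ge_zero order_trans)
    finally have "norm (z m) \<le> 2 * B" using B[of m] by simp
    moreover have "norm (w m) \<le> \<bar>\<epsilon> m\<bar> * norm (z m)"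
      using small[of m] by (meson abs_ge_self mult_right_mono norm_ge_zero order_trans)
    ultimately show ?case by (meson abs_ge_zero mult_left_mono order_trans)
  qed
  moreover have "(\<lambda>m. \<bar>\<epsilon> m\<bar> * (2 * B)) \<longlonglongrightarrow> 0"
    using tendsto_mult_left_zero[OF tendsto_rabs_zero[OF \<open>\<epsilon> \<longlonglongrightarrow> 0\<close>]] .
  ultimately have "w \<longlonglongrightarrow> 0"
    by (rule Lim_null_comparison)
  from tendsto_diff[OF lim this] show ?thesis by simp
qed

lemma norm_vector_smult: "norm (c *s (x :: complex ^ 'm::finite)) = norm c * norm x"
  by (simp add: norm_vec_def norm_mult L2_set_right_distrib)

lemma matrix_vector_bounded:
  fixes M :: "complex ^ 'm::finite ^ 'm"
  obtains B where "\<And>x. norm (M *v x) \<le> B * norm x"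
  using that linear_bounded[OF matrix_vector_mul_linear[of M]] by blast

text \<open>
  If \<open>u\<close> is cyclic for the commutant, there are commuting \<open>T\<^sub>i\<close> with \<open>T\<^sub>i u = e\<^sub>i\<close>.  A vector \<open>x\<close> near \<open>u\<close>
  is then \<open>(1 + R) u\<close> with \<open>R = \<Sum>\<^sub>i (x - u)\<^sub>i T\<^sub>i\<close> small, and \<open>M x = (1 + R) (M u)\<close>: moving the base point
  changes \<open>M u\<close> by a small relative amount, uniformly in \<open>M\<close>.
\<close>

lemma cyclic_vector_limit:
  fixes S :: "(complex ^ 'm ^ 'm::finite) set" and u :: "complex ^ 'm"
  assumes cyclic: "\<And>x. \<exists>T\<in>commutant S. T *v u = x"
    and Ms: "\<And>m. Ms m \<in> S" and xs: "xs \<longlonglongrightarrow> u"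
    and lim: "(\<lambda>m. Ms m *v xs m) \<longlonglongrightarrow> y"
  shows "(\<lambda>m. Ms m *v u) \<longlonglongrightarrow> y"
proof -
  have "\<exists>T. T \<in> commutant S \<and> T *v u = axis i 1" for i
    using cyclic by blast
  then obtain T where T: "\<And>i. T i \<in> commutant S" "\<And>i. T i *v u = axis i 1" by metis
  have "\<exists>B. \<forall>x. norm (T i *v x) \<le> B * norm x" for i
    using matrix_vector_bounded[of "T i"] by metis
  then obtain B where B: "\<And>i x. norm (T i *v x) \<le> B i * norm x" by metis
  define R where "R m x = (\<Sum>i\<in>UNIV. (xs m - u) $ i *s (T i *v x))" for m x
  have Ru: "R m (Ms m *v u) = Ms m *v (xs m - u)" for m
  proof -
    have "T i *v (Ms m *v u) = Ms m *v axis i 1" for i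
      using T Ms[of m] by (simp add: matrix_vector_mul_assoc commutant_def)
        (metis matrix_vector_mul_assoc)
    hence "R m (Ms m *v u) = (\<Sum>i\<in>UNIV. Ms m *v ((xs m - u) $ i *s axis i 1))"
      by (simp only: R_def vec.scale)
    also have "\<dots> = Ms m *v (xs m - u)"
      by (simp only: basis_expansion flip: vec.sum)
    finally show ?thesis .
  qed
  define \<epsilon> where "\<epsilon> m = (\<Sum>i\<in>UNIV. norm ((xs m - u) $ i) * B i)" for m
  show ?thesis
  proof (rule tendsto_perturbation)
    show "(\<lambda>m. Ms m *v u + R m (Ms m *v u)) \<longlonglongrightarrow> y"
      using lim by (simp add: Ru flip: matrix_vector_right_distrib)
    show "norm (R m (Ms m *v u)) \<le> \<epsilon> m * norm (Ms m *v u)" for m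
      unfolding R_def \<epsilon>_def sum_distrib_right mult.assoc
      by (intro sum_norm_le) (simp only: norm_vector_smult, intro mult_left_mono B norm_ge_zero)
    have "(\<lambda>m. xs m - u) \<longlonglongrightarrow> 0" using xs by (simp add: LIM_zero_iff)
    from tendsto_vec_nth[OF this] show "\<epsilon> \<longlonglongrightarrow> 0" unfolding \<epsilon>_def
      by (intro tendsto_null_sum tendsto_mult_left_zero tendsto_norm_zero) simp
  qed
qed

text \<open>
  The vectors \<open>T u\<close> with \<open>T\<close> in the commutant form an \<open>S\<close>-invariant subspace \<open>E\<close> containing \<open>u\<close>.  A common
  left eigenvector \<open>\<phi>\<close> that vanishes on \<open>E\<close> satisfies \<open>\<phi> (M x) x\<^sub>s = \<phi> x (M x)\<^sub>s\<close> for a coordinate \<open>s\<close> with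
  \<open>u\<^sub>s \<noteq> 0\<close>, because both sides equal \<open>M\<^sub>t\<^sub>t (\<phi> x) x\<^sub>s\<close>.  In the limit this gives \<open>\<phi> y u\<^sub>s = \<phi> u y\<^sub>s = 0\<close>
  for all \<open>y\<close> in the hyperplane, so \<open>\<phi> = 0\<close>.
\<close>

lemma cyclic_if_limits_cover_hyperplane:
  fixes S :: "(complex ^ 'm::{finite,wellorder} ^ 'm::_) set" and u :: "complex ^ 'm::_"
  assumes comm: "S \<subseteq> commutant S"
    and tri: "\<And>M. M \<in> S \<Longrightarrow> lower_triangular M"
    and diag: "\<And>t. \<exists>s. u $ s \<noteq> 0 \<and> (\<forall>M\<in>S. \<forall>x. (M *v x) $ s = M $ t $ t * x $ s)"
    and up: "u $ p = 1"
    and J: "\<And>y. y $ p = 1 \<Longrightarrow> \<exists>xs Ms. xs \<longlonglongrightarrow> u \<and> (\<forall>m. Ms m \<in> S) \<and> (\<lambda>m. Ms m *v xs m) \<longlonglongrightarrow> y"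
  shows "\<exists>T\<in>commutant S. T *v u = x"
proof -
  define E where "E = {T *v u |T. T \<in> commutant S}"
  have E: "vec.subspace E"
    using subspace_commutant_orbit[of UNIV u S] by (simp add: E_def)
  have inv: "M *v x \<in> E" if M: "M \<in> S" and x: "x \<in> E" for M x
  proof -
    obtain T where T: "T \<in> commutant S" "x = T *v u" using x unfolding E_def by blast
    have "M ** T \<in> commutant S"
      using T(1) comm M unfolding commutant_def
      by (smt (verit, best) matrix_mul_assoc mem_Collect_eq subsetD)
    thus ?thesis using T by (auto simp: E_def matrix_vector_mul_assoc)
  qed
  have "mat 1 \<in> commutant S" by (simp add: commutant_def)
  hence "u \<in> E" unfolding E_def using matrix_vector_mul_lid[of u] by (intro CollectI exI[of _ "mat 1"]) simp
  have "E = UNIV"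
  proof (rule ccontr)
    assume "E \<noteq> UNIV"
    define W where "W = {\<phi>. \<forall>x\<in>E. \<phi> \<star> x = 0}"
    have "vec.subspace W"
      by (auto simp: vec.subspace_def W_def pairing_add_left pairing_scale_left pairing_zero_left)
    moreover obtain \<psi> where "\<psi> \<noteq> 0" "\<And>x. x \<in> E \<Longrightarrow> \<psi> \<star> x = 0"
      using proper_subspace_annihilated[OF E \<open>E \<noteq> UNIV\<close>] by blast
    then have "W \<noteq> {0}" unfolding W_def by blast
    moreover have "\<phi> v* M \<in> W" if "\<phi> \<in> W" "M \<in> S" for \<phi> M
      using that inv by (simp add: W_def pairing_vector_matrix)
    ultimately obtain \<phi> t where \<phi>: "\<phi> \<in> W" "\<phi> \<noteq> 0"
      and eig: "\<And>M. M \<in> S \<Longrightarrow> \<phi> v* M = M $ t $ t *s \<phi>"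
      using lower_triangular_left_eigenvector[of W S] tri by metis
    obtain s where s: "u $ s \<noteq> 0" "\<And>M x. M \<in> S \<Longrightarrow> (M *v x) $ s = M $ t $ t * x $ s"
      using diag by metis
    have "\<phi> \<star> y = 0" if y: "y $ p = 1" for y
    proof -
      obtain xs Ms where xs: "xs \<longlonglongrightarrow> u" and Ms: "\<And>m. Ms m \<in> S"
        and lim: "(\<lambda>m. Ms m *v xs m) \<longlonglongrightarrow> y"
        using J[OF y] by metis
      have "(\<lambda>m. (\<phi> \<star> xs m) * (Ms m *v xs m) $ s) \<longlonglongrightarrow> (\<phi> \<star> u) * y $ s"
        by (intro tendsto_mult tendsto_pairing tendsto_vec_nth xs lim)
      moreover have "(\<phi> \<star> xs m) * (Ms m *v xs m) $ s = (\<phi> \<star> (Ms m *v xs m)) * xs m $ s" for m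
        using pairing_vector_matrix[of \<phi> "Ms m" "xs m"] Ms[of m]
        by (simp add: eig s(2) pairing_scale_left mult.commute)
      moreover have "(\<lambda>m. (\<phi> \<star> (Ms m *v xs m)) * xs m $ s) \<longlonglongrightarrow> (\<phi> \<star> y) * u $ s"
        by (intro tendsto_mult tendsto_pairing tendsto_vec_nth xs lim)
      ultimately have "(\<phi> \<star> u) * y $ s = (\<phi> \<star> y) * u $ s"
        using LIMSEQ_unique by simp
      moreover have "\<phi> \<star> u = 0" using \<phi>(1) \<open>u \<in> E\<close> by (simp add: W_def)
      ultimately show ?thesis using s(1) by simp
    qed
    hence "\<phi> = 0" by (rule functional_vanishing_on_hyperplane)
    with \<phi>(2) show False by simp
  qed
  hence "x \<in> E" by simp
  thus ?thesis unfolding E_def by blast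
qed

section \<open>Block triangular matrices\<close>

lemma rank_of_less_iff: "rank_of i < rank_of j \<longleftrightarrow> i < (j :: 'm::{finite,wellorder})"
proof -
  have "rank_of i < rank_of j" if "i < j" for i j :: 'm
    unfolding rank_of_def using that by (intro psubset_card_mono) auto
  thus ?thesis by (metis not_less_iff_gr_or_eq)
qed

lemma range_rank_of: "range (rank_of :: 'm::{finite,wellorder} \<Rightarrow> nat) = {..<CARD('m)}"
proof (rule card_subset_eq)
  show "range (rank_of :: 'm \<Rightarrow> nat) \<subseteq> {..<CARD('m)}"
    unfolding rank_of_def by (auto intro!: psubset_card_mono)
  have "inj (rank_of :: 'm \<Rightarrow> nat)"
    by (rule injI) (metis rank_of_less_iff less_irrefl linorder_less_linear)
  thus "card (range (rank_of :: 'm \<Rightarrow> nat)) = card {..<CARD('m)}"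
    by (simp add: card_image)
qed simp

lemma between_partial_sums:
  "n < sum_list \<eta> \<Longrightarrow> \<exists>k<length \<eta>. sum_list (take k \<eta>) \<le> n \<and> n < sum_list (take (Suc k) \<eta>)"
  for n :: nat
proof (induction \<eta> arbitrary: n)
  case (Cons a \<eta>)
  show ?case
  proof (cases "n < a")
    case True
    then show ?thesis by (intro exI[of _ 0]) auto
  next
    case False
    hence "n - a < sum_list \<eta>" using Cons.prems by simp
    then obtain k where "k < length \<eta>" "sum_list (take k \<eta>) \<le> n - a" "n - a < sum_list (take (Suc k) \<eta>)"
      using Cons.IH by blast
    with False show ?thesis by (intro exI[of _ "Suc k"]) auto
  qed
qed simp

context
  fixes \<eta> :: "nat list"
  assumes size: "sum_list \<eta> = CARD('m::{finite,wellorder})"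
begin

lemma blocks_cover: "\<exists>k<length \<eta>. (i :: 'm) \<in> block \<eta> k"
  using between_partial_sums[of "rank_of i" \<eta>] range_rank_of[where 'm='m] size
  by (auto simp: block_def)

lemma K_set_lower_triangular:
  assumes M: "(M :: complex ^ 'm::_ ^ 'm::_) \<in> K_set \<eta>" shows "lower_triangular M"
  unfolding lower_triangular_def
proof (intro allI impI)
  fix i j :: 'm assume "i < j"
  obtain k l where "k < length \<eta>" "i \<in> block \<eta> k" "l < length \<eta>" "j \<in> block \<eta> l"
    using blocks_cover by metis
  thus "M $ i $ j = 0"
    using M \<open>i < j\<close> by (cases "k = l") (auto simp: K_set_def T_on_def)
qed

text \<open>
  The start of a block is the least index of the block, so within the block the row of a lower
  triangular matrix has only its diagonal entry.  Blocks of size zero may share the starting rank;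
  the start then belongs to another block, and an index before it is still in a different block.
\<close>

lemma K_set_block_start:
  assumes M: "(M :: complex ^ 'm::_ ^ 'm::_) \<in> K_set \<eta>" and s: "u0 \<eta> $ s = (1::complex)"
  shows "(M *v x) $ s = M $ s $ s * x $ s"
proof -
  have "M $ s $ j = 0" if "j \<noteq> s" for j
  proof (cases "s < j")
    case True
    then show ?thesis using K_set_lower_triangular[OF M] by (simp add: lower_triangular_def)
  next
    case False
    hence "j < s" using that by simp
    obtain k where k: "k < length \<eta>" "rank_of s = sum_list (take k \<eta>)"
      using s by (auto simp: u0_def split: if_splits)
    obtain l where l: "l < length \<eta>" "j \<in> block \<eta> l" using blocks_cover by metis
    obtain l' where l': "l' < length \<eta>" "s \<in> block \<eta> l'" using blocks_cover by metis
    have "l \<noteq> l'"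
    proof
      assume "l = l'"
      hence *: "sum_list (take l \<eta>) \<le> rank_of j" "rank_of j < sum_list (take k \<eta>)"
        "sum_list (take k \<eta>) < sum_list (take (Suc l) \<eta>)"
        using l(2) l'(2) k(2) rank_of_less_iff[of j s] \<open>j < s\<close> by (auto simp: block_def)
      have mono: "sum_list (take a \<eta>) \<le> sum_list (take b \<eta>)" if "a \<le> b" for a b
        using that by (metis le_add1 le_add_diff_inverse sum_list_append take_add)
      show False
        using * mono[of k l] mono[of "Suc l" k] by (cases "k \<le> l") auto
    qed
    thus ?thesis using M l l' by (auto simp: K_set_def)
  qed
  hence "(\<Sum>j\<in>UNIV. M $ s $ j * x $ j) = (\<Sum>j\<in>UNIV. if j = s then M $ s $ s * x $ s else 0)"
    by (intro sum.cong) auto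
  thus ?thesis by (simp add: matrix_vector_mult_def)
qed

text \<open>
  The index \<open>s\<close> is the start of the block containing \<open>t\<close>; it serves all matrices at once, which the
  limit arguments along sequences of matrices need.
\<close>

lemma K_set_diagonal:
  assumes "\<forall>m\<in>set \<eta>. m > 0"
  shows "\<exists>s :: 'm. u0 \<eta> $ s = (1::complex) \<and> (\<forall>M\<in>K_set \<eta>. M $ t $ t = M $ s $ s)"
proof -
  obtain k where k: "k < length \<eta>" "t \<in> block \<eta> k" using blocks_cover by blast
  have "sum_list (take k \<eta>) < CARD('m)"
    using k(2) range_rank_of[where 'm='m] by (auto simp: block_def set_eq_iff intro: le_less_trans)
  then obtain s :: 'm where s: "rank_of s = sum_list (take k \<eta>)"
    using range_rank_of[where 'm='m] by (metis imageE lessThan_iff)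
  have "s \<in> block \<eta> k"
    using k assms by (simp add: block_def s take_Suc_conv_app_nth)
  hence "M $ t $ t = M $ s $ s" if "M \<in> K_set \<eta>" for M :: "complex ^ 'm::_ ^ 'm::_"
    using that k unfolding K_set_def T_on_def by blast
  moreover have "u0 \<eta> $ s = (1::complex)" using k(1) s by (auto simp: u0_def)
  ultimately show ?thesis by blast
qed

end

lemma T_on_subspace:
  shows T_on_zero: "T_on B 0"
    and T_on_add: "T_on B M \<Longrightarrow> T_on B N \<Longrightarrow> T_on B (M + N)"
    and T_on_scale: "T_on B M \<Longrightarrow> T_on B (mat c ** M)"
  unfolding T_on_def mat_mult_eq vector_add_component vec_lambda_beta zero_index
  by (blast, metis add.right_neutral, metis mult_zero_right)

lemma K_set_subspace:
  shows K_set_zero: "0 \<in> K_set \<eta>"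
    and K_set_add: "M \<in> K_set \<eta> \<Longrightarrow> N \<in> K_set \<eta> \<Longrightarrow> M + N \<in> K_set \<eta>"
    and K_set_scale: "M \<in> K_set \<eta> \<Longrightarrow> mat c ** M \<in> K_set \<eta>"
  unfolding K_set_def by (simp_all add: T_on_subspace) (simp add: mat_mult_eq)

section \<open>Transfer of density between orbits\<close>

text \<open>
  A dense orbit spans, so \<open>u0 \<eta> = T v\<close> for a \<open>T\<close> in \<open>K_set \<eta>\<close> that commutes with \<open>S\<close>.  At a block start
  \<open>s\<close> this reads \<open>1 = T\<^sub>s\<^sub>s v\<^sub>s\<close>, so no diagonal entry of \<open>T\<close> vanishes; at \<open>p\<close> it gives \<open>T\<^sub>p\<^sub>p = 1\<close>.  Hence
  \<open>T\<close> maps the hyperplane onto itself.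
\<close>

lemma dense_orbit_transfer:
  fixes S :: "(complex ^ 'm::{finite,wellorder} ^ 'm::_) set" and v :: "complex ^ 'm::_"
  assumes size: "sum_list \<eta> = CARD('m)" and pos: "\<forall>m\<in>set \<eta>. m > 0"
    and comm: "S \<subseteq> commutant S" and K: "S \<subseteq> K_set \<eta>"
    and p: "u0 \<eta> $ p = (1::complex)" "v $ p = 1"
    and dense: "{y. y $ p = 1} \<subseteq> closure {M *v v |M. M \<in> S}"
  shows "{y. y $ p = 1} \<subseteq> closure {M *v u0 \<eta> |M. M \<in> S}"
proof -
  define E where "E = {T *v v |T. T \<in> K_set \<eta> \<inter> commutant S}"
  have E: "vec.subspace E"
    unfolding E_def by (rule subspace_commutant_orbit) (auto intro: K_set_subspace)
  have "E = UNIV"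
  proof (rule ccontr)
    assume "E \<noteq> UNIV"
    then obtain \<phi> where \<phi>: "\<phi> \<noteq> 0" "\<And>x. x \<in> E \<Longrightarrow> \<phi> \<star> x = 0"
      using proper_subspace_annihilated[OF E] by blast
    have "closed {y. \<phi> \<star> y = 0}"
      by (intro closed_Collect_eq continuous_pairing continuous_on_const)
    moreover have "{M *v v |M. M \<in> S} \<subseteq> {y. \<phi> \<star> y = 0}"
    proof clarify
      fix M assume "M \<in> S"
      hence "M *v v \<in> E" using K comm unfolding E_def by blast
      thus "\<phi> \<star> (M *v v) = 0" by (rule \<phi>(2))
    qed
    ultimately have "{y. y $ p = 1} \<subseteq> {y. \<phi> \<star> y = 0}"
      using dense by (meson closure_minimal order_trans)
    hence "\<phi> = 0" by (intro functional_vanishing_on_hyperplane[of p]) auto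
    with \<phi>(1) show False by simp
  qed
  hence "u0 \<eta> \<in> E" by simp
  then obtain T where T: "T \<in> K_set \<eta>" "T \<in> commutant S" "T *v v = u0 \<eta>"
    unfolding E_def by auto
  have "T $ t $ t \<noteq> 0" for t
  proof -
    obtain s where s: "u0 \<eta> $ s = (1::complex)" "T $ t $ t = T $ s $ s"
      using K_set_diagonal[OF size pos] T(1) by metis
    thus ?thesis using K_set_block_start[OF size T(1) s(1), of v] T(3) by auto
  qed
  hence "det T \<noteq> 0"
    using K_set_lower_triangular[OF size T(1)]
    by (subst det_lowerdiagonal) (auto simp: lower_triangular_def)
  then obtain R where R: "T ** R = mat 1"
    using invertible_det_nz invertible_right_inverse by metis
  have Tp: "(T *v x) $ p = x $ p" for x
    using K_set_block_start[OF size T(1) p(1), of v] K_set_block_start[OF size T(1) p(1), of x] T(3) p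
    by simp
  show ?thesis
  proof
    fix y :: "complex ^ 'm::_" assume "y \<in> {y. y $ p = 1}"
    moreover have y: "y = T *v (R *v y)" by (simp add: matrix_vector_mul_assoc R)
    ultimately have "R *v y \<in> closure {M *v v |M. M \<in> S}"
      using Tp[of "R *v y"] dense by auto
    moreover have "(*v) T ` closure {M *v v |M. M \<in> S} \<subseteq> closure {M *v u0 \<eta> |M. M \<in> S}"
    proof (rule image_closure_subset[OF continuous_matrix_vector_mult closed_closure])
      have "T *v (M *v v) = M *v u0 \<eta>" if "M \<in> S" for M
        using T(2,3) that by (simp add: commutant_def matrix_vector_mul_assoc)
          (metis matrix_vector_mul_assoc)
      hence "(*v) T ` {M *v v |M. M \<in> S} \<subseteq> {M *v u0 \<eta> |M. M \<in> S}" by auto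
      thus "(*v) T ` {M *v v |M. M \<in> S} \<subseteq> closure {M *v u0 \<eta> |M. M \<in> S}"
        using closure_subset by blast
    qed
    ultimately show "y \<in> closure {M *v u0 \<eta> |M. M \<in> S}" using y by blast
  qed
qed

section \<open>Affine maps in homogeneous coordinates\<close>

lemma sum_UNIV_option:
  "(\<Sum>i\<in>UNIV. f i) = f None + (\<Sum>i\<in>UNIV. f (Some (i::'n::finite)))"
  by (simp add: UNIV_option_conv sum.reindex)

definition homogenize :: "complex ^ 'n \<Rightarrow> complex ^ ('n::finite) option"
  where "homogenize x = (\<chi> i. case i of None \<Rightarrow> 1 | Some j \<Rightarrow> x $ j)"

lemma homogenize_None [simp]: "homogenize x $ None = 1"
  by (simp add: homogenize_def)

lemma p2_homogenize [simp]: "p2 (homogenize x) = x"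
  by (simp add: p2_def homogenize_def vec_eq_iff)

lemma homogenize_p2: "x $ None = 1 \<Longrightarrow> homogenize (p2 x) = x"
  by (auto simp: p2_def homogenize_def vec_eq_iff split: option.split)

lemma continuous_homogenize:
  fixes A :: "(complex ^ 'n::finite) set"
  shows "continuous_on A homogenize"
  unfolding homogenize_def
proof (rule continuous_on_vec_lambda)
  fix i :: "'n option"
  show "continuous_on A (\<lambda>x. case i of None \<Rightarrow> 1 | Some j \<Rightarrow> x $ j)"
    by (cases i) (auto intro: continuous_intros)
qed

lemma continuous_p2: "continuous_on A p2"
  unfolding p2_def by (intro continuous_intros)

lemma Phi_homogenize: "Phi A a *v homogenize x = homogenize (affine_map A a x)"
  by (auto simp: vec_eq_iff Phi_def homogenize_def affine_map_def matrix_vector_mult_def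
      sum_UNIV_option split: option.split)

lemma Phi_None: "(Phi A a *v x) $ None = x $ None"
  by (simp add: Phi_def matrix_vector_mult_def sum_UNIV_option)

lemma Phi_mult: "Phi A a ** Phi B b = Phi (A ** B) (A *v b + a)"
  by (auto simp: vec_eq_iff Phi_def matrix_matrix_mult_def matrix_vector_mult_def
      sum_UNIV_option split: option.split)

lemma Phi_one: "Phi (mat 1) 0 = mat 1"
  by (auto simp: vec_eq_iff Phi_def mat_def split: option.split)

lemma affine_map_comp: "affine_map A a \<circ> affine_map B b = affine_map (A ** B) (A *v b + a)"
  by (auto simp: affine_map_def fun_eq_iff matrix_vector_right_distrib matrix_vector_mul_assoc)

lemma affine_map_inject:
  assumes "affine_map A a = affine_map B b" shows "A = B" "a = b"
proof -
  have eq: "A *v x + a = B *v x + b" for x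
    using assms by (simp add: affine_map_def fun_eq_iff)
  from eq[of 0] show "a = b" by simp
  with eq show "A = B" by (simp add: matrix_eq)
qed

lemma Phi_image_commute:
  assumes "abelian G" "M \<in> Phi_image G" "N \<in> Phi_image G"
  shows "M ** N = N ** M"
proof -
  obtain A a B b where M: "M = Phi A a" "affine_map A a \<in> G"
    and N: "N = Phi B b" "affine_map B b \<in> G"
    using assms(2,3) by (auto simp: Phi_image_def)
  have "affine_map (A ** B) (A *v b + a) = affine_map (B ** A) (B *v a + b)"
    using assms(1) M(2) N(2) unfolding abelian_def affine_map_comp[symmetric] by blast
  from affine_map_inject[OF this] show ?thesis by (simp add: M N Phi_mult)
qed

lemma invertible_Phi:
  assumes "invertible A" shows "invertible (Phi A a)"
proof -
  obtain B where "A ** B = mat 1" using assms by (auto simp: invertible_def)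
  hence "Phi A a ** Phi B (- (B *v a)) = mat 1"
    by (simp add: Phi_mult Phi_one matrix_vector_mul_assoc flip: vec.neg)
  thus ?thesis using invertible_right_inverse by blast
qed

lemma Phi_image_GA:
  assumes "P \<in> Phi_image GA"
  shows "invertible P" "(P *v x) $ None = x $ None"
  using assms affine_map_inject(1)
  by (auto simp: Phi_image_def GA_def Phi_None intro!: invertible_Phi)

lemma matrix_inv_mult:
  assumes "invertible A" shows "A ** matrix_inv A = mat 1" "matrix_inv A ** A = mat 1"
  using someI_ex[OF assms[unfolded invertible_def]] unfolding matrix_inv_def by blast+

lemma semigroup_generated_affine:
  assumes "F \<subseteq> MA" "f \<in> semigroup_generated F" shows "f \<in> MA"
  using assms(2)
proof induction
  case (gen f)
  then show ?case using assms(1) by blast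
next
  case (comp f g)
  then show ?case unfolding MA_def using affine_map_comp by blast
qed

section \<open>The equivalence for affine semigroups\<close>

theorem corollary1p2:
  fixes fs :: "(complex ^ 'n::{finite,wellorder} \<Rightarrow> complex ^ 'n::_) list"
    and G :: "(complex ^ 'n::_ \<Rightarrow> complex ^ 'n::_) set"
    and P :: "complex ^ ('n::_) option ^ ('n::_) option"
    and \<eta> :: "nat list"
    and w0 :: "complex ^ 'n::_"
  assumes "fs \<noteq> []"
    and "set fs \<subseteq> MA"
    and "G = semigroup_generated (set fs)"
    and "abelian G"
    and "P \<in> Phi_image GA"
    and "\<forall>m\<in>set \<eta>. m > 0"
    and "sum_list \<eta> = CARD('n) + 1"
    and "{matrix_inv P ** M ** P |M. M \<in> Phi_image G} \<subseteq> K_set \<eta>"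
    and "w0 = p2 (P *v u0 \<eta>)"
  shows "(hypercyclic G \<longleftrightarrow> J_set fs w0 = UNIV) \<and>
         (J_set fs w0 = UNIV \<longleftrightarrow> closure (orbit_of G w0) = UNIV)"
proof -
  define Q where "Q = matrix_inv P"
  define h where "h x = Q *v homogenize x" for x
  define S where "S = {Q ** M ** P |M. M \<in> Phi_image G}"
  have P: "invertible P" "(P *v x) $ None = x $ None" for x
    by (fact Phi_image_GA[OF assms(5)])+
  have PQ: "P ** Q = mat 1" "Q ** P = mat 1"
    unfolding Q_def by (simp_all add: matrix_inv_mult P(1))
  have S_K: "S \<subseteq> K_set \<eta>" using assms(8) by (simp add: S_def Q_def)
  have size: "sum_list \<eta> = CARD('n option)" using assms(7) by simp
  have S_comm: "S \<subseteq> commutant S"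
  proof -
    have "(Q ** M ** P) ** (Q ** N ** P) = Q ** (M ** N) ** P" for M N
      by (metis PQ(1) matrix_mul_assoc matrix_mul_rid)
    thus ?thesis using Phi_image_commute[OF assms(4)]
      unfolding S_def commutant_def by (smt (verit) mem_Collect_eq subsetI)
  qed
  have Q_None: "(Q *v x) $ None = x $ None" for x
    using P(2)[of "Q *v x"] by (simp add: matrix_vector_mul_assoc PQ)
  have h_None: "h x $ None = 1" for x by (simp add: h_def Q_None)
  have h_inv: "h (p2 (P *v y)) = y" if "y $ None = 1" for y
    using that P(2)[of y] by (simp add: h_def homogenize_p2 matrix_vector_mul_assoc PQ)
  have inv_h: "p2 (P *v h x) = x" for x
    by (simp add: h_def matrix_vector_mul_assoc PQ)
  have h_cont: "continuous_on A h" for A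
    unfolding h_def using continuous_on_compose[OF continuous_homogenize continuous_matrix_vector_mult]
    by (simp add: comp_def)
  have inv_h_cont: "continuous_on A (\<lambda>y. p2 (P *v y))" for A
    using continuous_on_compose[OF continuous_matrix_vector_mult continuous_p2] by (simp add: comp_def)
  have u0_None: "u0 \<eta> $ (None :: 'n option) = (1::complex)"
  proof -
    have "rank_of (None :: 'n option) = 0" by (simp add: rank_of_def)
    moreover have "\<eta> \<noteq> []" using size by auto
    ultimately show ?thesis unfolding u0_def by (auto intro!: exI[of _ 0])
  qed
  have h_w0: "h w0 = u0 \<eta>" using h_inv u0_None assms(9) by simp
  have conj: "h (affine_map A a x) = (Q ** Phi A a ** P) *v h x" for A a x
    by (simp add: h_def Phi_homogenize[symmetric] matrix_vector_mul_assoc PQ)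
      (metis PQ(1) matrix_mul_assoc matrix_mul_rid)
  have G_S: "\<exists>M\<in>S. \<forall>x. h (f x) = M *v h x" if f: "f \<in> G" for f
  proof -
    obtain A a where "f = affine_map A a"
      using semigroup_generated_affine[OF assms(2)] f assms(3) unfolding MA_def by blast
    thus ?thesis using f conj unfolding S_def Phi_image_def by blast
  qed
  have S_G: "\<exists>f\<in>G. \<forall>x. h (f x) = M *v h x" if "M \<in> S" for M
    using that conj unfolding S_def Phi_image_def by blast

  let ?H = "{y :: complex ^ 'n option. y $ None = 1}"
  have orbit_to_linear: "?H \<subseteq> closure {M *v h v |M. M \<in> S}" if "closure (orbit_of G v) = UNIV" for v
  proof -
    have "h ` orbit_of G v \<subseteq> {M *v h v |M. M \<in> S}"
      using G_S unfolding orbit_of_def by fastforce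
    hence "h ` closure (orbit_of G v) \<subseteq> closure {M *v h v |M. M \<in> S}"
      by (intro image_closure_subset h_cont closed_closure order_trans[OF _ closure_subset])
    hence image: "h x \<in> closure {M *v h v |M. M \<in> S}" for x using that by blast
    show ?thesis
    proof clarify
      fix y :: "complex ^ 'n option" assume "y $ None = 1"
      with image[of "p2 (P *v y)"] show "y \<in> closure {M *v h v |M. M \<in> S}" by (simp add: h_inv)
    qed
  qed
  have linear_to_orbit: "closure (orbit_of G w0) = UNIV"
    if "?H \<subseteq> closure {M *v u0 \<eta> |M. M \<in> S}"
  proof -
    have "p2 (P *v (M *v u0 \<eta>)) \<in> orbit_of G w0" if M: "M \<in> S" for M
      using S_G[OF M] inv_h unfolding orbit_of_def h_w0[symmetric]
      by (metis (mono_tags, lifting) mem_Collect_eq)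
    hence "(\<lambda>y. p2 (P *v y)) ` {M *v u0 \<eta> |M. M \<in> S} \<subseteq> orbit_of G w0" by blast
    hence "(\<lambda>y. p2 (P *v y)) ` closure {M *v u0 \<eta> |M. M \<in> S} \<subseteq> closure (orbit_of G w0)"
      by (intro image_closure_subset inv_h_cont closed_closure order_trans[OF _ closure_subset])
    hence "p2 (P *v h x) \<in> closure (orbit_of G w0)" for x
      using that h_None[of x] by blast
    thus ?thesis by (auto simp: inv_h)
  qed

  have i_iii: "closure (orbit_of G w0) = UNIV" if hyp: "hypercyclic G"
  proof -
    obtain v where "closure (orbit_of G v) = UNIV" using hyp by (auto simp: hypercyclic_def)
    from orbit_to_linear[OF this] show ?thesis
      by (intro linear_to_orbit dense_orbit_transfer[OF size assms(6) S_comm S_K u0_None h_None])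
  qed
  have ii_iii: "closure (orbit_of G w0) = UNIV" if J: "J_set fs w0 = UNIV"
  proof (rule linear_to_orbit)
    have lim: "\<exists>xs Ms. xs \<longlonglongrightarrow> u0 \<eta> \<and> (\<forall>m. Ms m \<in> S) \<and> (\<lambda>m. Ms m *v xs m) \<longlonglongrightarrow> y"
      if y: "y $ None = 1" for y
    proof -
      obtain xs k where xs: "xs \<longlonglongrightarrow> w0"
        and k: "filterlim (\<lambda>m. \<Sum>j<length fs. k m j) at_top sequentially"
        and lim: "(\<lambda>m. power_product fs (k m) (xs m)) \<longlonglongrightarrow> p2 (P *v y)"
        using J unfolding J_set_def by blast
      \<comment> \<open>a power product with all exponents zero is the identity, which need not belong to \<open>G\<close>\<close>
      obtain N where N: "\<And>m. m \<ge> N \<Longrightarrow> (\<Sum>j<length fs. k m j) \<ge> 1"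
        using k unfolding filterlim_at_top eventually_sequentially by meson
      have "power_product fs (k (m + N)) \<in> G" for m
        unfolding assms(3) using N[of "m + N"] by (intro power_product_in_semigroup) auto
      hence "\<exists>M\<in>S. \<forall>x. h (power_product fs (k (m + N)) x) = M *v h x" for m
        by (rule G_S)
      then obtain Ms where Ms: "\<And>m. Ms m \<in> S"
        "\<And>m x. h (power_product fs (k (m + N)) x) = Ms m *v h x"
        by metis
      have cont: "isCont h x" for x
        using h_cont[of UNIV] by (simp add: continuous_on_eq_continuous_at)
      have "(\<lambda>m. h (xs (m + N))) \<longlonglongrightarrow> u0 \<eta>"
        using isCont_tendsto_compose[OF cont LIMSEQ_ignore_initial_segment[OF xs, of N]] by (simp add: h_w0)
      moreover have "(\<lambda>m. Ms m *v h (xs (m + N))) \<longlonglongrightarrow> y"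
        using isCont_tendsto_compose[OF cont LIMSEQ_ignore_initial_segment[OF lim, of N]]
        by (simp add: Ms(2) h_inv y)
      ultimately show ?thesis using Ms(1) by blast
    qed
    have diag: "\<exists>s. u0 \<eta> $ s \<noteq> 0 \<and> (\<forall>M\<in>S. \<forall>x. (M *v x) $ s = M $ t $ t * x $ s)" for t :: "'n option"
    proof -
      obtain s where s: "u0 \<eta> $ s = (1::complex)" "\<forall>M\<in>K_set \<eta>. M $ t $ t = M $ s $ s"
        using K_set_diagonal[OF size assms(6), of t] by blast
      have "(M *v x) $ s = M $ t $ t * x $ s" if "M \<in> S" for M x
      proof -
        have M: "M \<in> K_set \<eta>" using that S_K by blast
        show ?thesis using K_set_block_start[OF size M s(1)] s(2) M by simp
      qed
      with s(1) show ?thesis by (intro exI[of _ s]) simp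
    qed
    have tri: "lower_triangular M" if "M \<in> S" for M
      using that S_K by (intro K_set_lower_triangular[OF size]) blast
    have cyclic: "\<exists>T\<in>commutant S. T *v u0 \<eta> = x" for x
      by (rule cyclic_if_limits_cover_hyperplane[OF S_comm tri diag u0_None lim])
    show "?H \<subseteq> closure {M *v u0 \<eta> |M. M \<in> S}"
    proof clarify
      fix y :: "complex ^ 'n option" assume "y $ None = 1"
      from lim[OF this] obtain xs Ms where "xs \<longlonglongrightarrow> u0 \<eta>" and Ms: "\<forall>m. Ms m \<in> S"
        and "(\<lambda>m. Ms m *v xs m) \<longlonglongrightarrow> y" by blast
      with cyclic have "(\<lambda>m. Ms m *v u0 \<eta>) \<longlonglongrightarrow> y"
        by (intro cyclic_vector_limit[of S "u0 \<eta>" Ms xs]) auto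
      with Ms show "y \<in> closure {M *v u0 \<eta> |M. M \<in> S}"
        unfolding closure_sequential by (intro exI[of _ "\<lambda>m. Ms m *v u0 \<eta>"]) auto
    qed
  qed
  have iii_ii: "J_set fs w0 = UNIV" if "closure (orbit_of G w0) = UNIV"
    using that assms(3,4) by (intro dense_orbit_imp_J_set) auto
  have iii_i: "hypercyclic G" if "closure (orbit_of G w0) = UNIV"
    using that by (auto simp: hypercyclic_def)
  show ?thesis using i_iii ii_iii iii_ii iii_i by blast
qed

end
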